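(* Let $G$ be a cubic (i.e. $3$-regular) graph of order $10$. Let $g_{3,0,1}$, $g_{4,0,1}$ and $g_{5,0,1}$ denote the numbers of subgraphs of $G$ that are cycles on $3$, $4$ and $5$ vertices, respectively, and let $g_{5,0,2}$ denote the number of subgraphs of $G$ isomorphic to $Q$, where $Q$ is the graph on $4$ vertices with $5$ edges (that is, $K_4$ with one edge removed). Then the matching polynomial of $G$ is $$\begin{aligned} \mu(G,x)={}&x^{10}-15x^8+75x^6-145x^4+90x^2-18+(x^4-3x^2+3)\,g_{3,0,1}\\ &+(x^2+1)\,g_{4,0,1}+g_{5,0,1}-4\,g_{5,0,2}. \end{aligned}$$
   Context: Graphs are finite and simple; the order of a graph is its number of vertices. A $k$-matching in a graph $G$ is a set of $k$ edges of $G$, no two of which share a vertex; $\rho(G,k)$ denotes the number of $k$-matchings of $G$, with $\rho(G,0)=1$. The matching polynomial of a graph $G$ of order $n$ is $\mu(G,x)=\sum_{k=0}^{\lfloor n/2\rfloor}(-1)^k\rho(G,k)x^{n-2k}$. Subgraphs are counted as (not necessarily induced) subgraphs, i.e. as distinct edge subsets of $G$ forming a copy of the given graph. *)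

theory Defs
  imports "HOL-Computational_Algebra.Polynomial"
begin

type_synonym 'a ugraph = "'a set \<times> 'a set set"

abbreviation verts :: "'a ugraph \<Rightarrow> 'a set" where
  "verts G \<equiv> fst G"

abbreviation edges :: "'a ugraph \<Rightarrow> 'a set set" where
  "edges G \<equiv> snd G"

definition finite_simple_graph :: "'a ugraph \<Rightarrow> bool" where
  "finite_simple_graph G \<longleftrightarrow>
     finite (verts G) \<and> (\<forall>e\<in>edges G. e \<subseteq> verts G \<and> card e = 2)"

definition graph_order :: "'a ugraph \<Rightarrow> nat" where
  "graph_order G = card (verts G)"

definition vertex_degree :: "'a ugraph \<Rightarrow> 'a \<Rightarrow> nat" where
  "vertex_degree G v = card {e \<in> edges G. v \<in> e}"

definition regular :: "nat \<Rightarrow> 'a ugraph \<Rightarrow> bool" where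
  "regular r G \<longleftrightarrow> (\<forall>v\<in>verts G. vertex_degree G v = r)"

definition k_matchings :: "'a ugraph \<Rightarrow> nat \<Rightarrow> 'a set set set" where
  "k_matchings G k = {M. M \<subseteq> edges G \<and> card M = k \<and> pairwise disjnt M}"

definition num_matchings :: "'a ugraph \<Rightarrow> nat \<Rightarrow> nat" where
  "num_matchings G k = card (k_matchings G k)"

definition matching_poly :: "'a ugraph \<Rightarrow> int poly" where
  "matching_poly G =
     (\<Sum>k = 0..graph_order G div 2.
        monom ((-1) ^ k * int (num_matchings G k)) (graph_order G - 2 * k))"

definition graph_iso :: "'a ugraph \<Rightarrow> 'b ugraph \<Rightarrow> bool" where
  "graph_iso G H \<longleftrightarrow>
     (\<exists>f. bij_betw f (verts G) (verts H) \<and> edges H = (\<lambda>e. f ` e) ` edges G)"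

text \<open>Subgraphs need not be induced and are identified with their edge sets; the vertex set
  of the subgraph is the union of its edges. This is the usual count of copies of \<open>H\<close>
  in \<open>G\<close> whenever \<open>H\<close> has no isolated vertices.\<close>

definition num_subgraphs :: "'b ugraph \<Rightarrow> 'a ugraph \<Rightarrow> nat" where
  "num_subgraphs H G = card {F. F \<subseteq> edges G \<and> graph_iso (\<Union>F, F) H}"

text \<open>A cycle only for \<open>n \<ge> 3\<close>.\<close>

definition cycle_graph :: "nat \<Rightarrow> nat ugraph" where
  "cycle_graph n = ({..<n}, {{i, Suc i mod n} |i. i < n})"

definition complete_graph :: "nat \<Rightarrow> nat ugraph" where
  "complete_graph n = ({..<n}, {e. e \<subseteq> {..<n} \<and> card e = 2})"

definition Q_graph :: "nat ugraph" where
  "Q_graph = (verts (complete_graph 4), edges (complete_graph 4) - {{0, 1}})"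

end

theory Submission
  imports Defs "HOL-Combinatorics.Multiset_Permutations"
begin

text \<open>
  The coefficients of the matching polynomial are numbers of matchings, and they are found by
  counting labelled embeddings: \<open>emb G m E\<close> is the number of injective maps from \<open>{..<m}\<close> to the
  vertices of \<open>G\<close> that send the edges listed in \<open>E\<close> to edges of \<open>G\<close>.

  In a \<open>d\<close>-regular graph a pendant vertex can be eliminated. If the last vertex is attached to \<open>w\<close>
  only, then its image is one of the \<open>d\<close> neighbours of the image of \<open>w\<close>, but not the image of an
  earlier vertex \<open>j\<close>; hence \<open>emb\<close> of the pattern is \<open>d\<close> times \<open>emb\<close> of the pattern without the
  pendant vertex, minus the sum over \<open>j\<close> of \<open>emb\<close> of that smaller pattern with the edge from \<open>w\<close> to
  \<open>j\<close> added (\<open>emb_pendant\<close>). A disjoint edge can be eliminated in a similar way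
  (\<open>emb_far_edge\<close>). Neither step increases the number of edges, and both reduce the number of
  vertices, so a \<open>k\<close>-matching with \<open>k \<le> 5\<close> is finally expressed by patterns of minimum degree at
  least two with at most five edges. These are the cycles of length three, four and five and the
  graph \<open>K\<^sub>4\<close> minus an edge, here called the diamond, which explains why exactly these four
  numbers of subgraphs occur in the formula.

  Explicitly, adding a disjoint edge to a \<open>k\<close>-matching leads to matchings two of whose edges are
  linked, that is, to a path on four vertices with disjoint edges. Adding a disjoint edge to these
  in turn leads to a path on six vertices, a spider, and patterns that contain a triangle or a
  four-cycle, and these reduce further by removing pendant vertices. The terms of each reduction are
  identified up to isomorphism by a certified search (\<open>emb_isomorphic\<close>, \<open>sum_emb_census\<close>), which
  makes every relation a finite computation.

  Subgraphs and embeddings differ by the factor given by the number of automorphisms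
  (\<open>emb_eq_automorphisms_times_subgraphs\<close>): 6, 8 and 10 for the cycles, 4 for the diamond, and
  \<open>2 ^ k * fact k\<close> for a \<open>k\<close>-matching (\<open>emb_matching_pattern\<close>). Solving the linear system then
  gives the numbers of \<open>k\<close>-matchings for all \<open>k \<le> 5\<close>.
\<close>

section \<open>Labelled embeddings of small graphs\<close>

text \<open>A pattern is a graph on the vertices \<open>{..<m}\<close>, given by a list of edges so that it can be
  computed with; \<open>m\<close> is kept separate because isolated vertices matter. A list \<open>xs\<close> of length
  \<open>m\<close> draws the pattern by sending vertex \<open>i\<close> to \<open>xs ! i\<close>.\<close>
type_synonym pattern = "(nat \<times> nat) list"

definition wf_pattern :: "nat \<Rightarrow> pattern \<Rightarrow> bool" where
  "wf_pattern m E \<longleftrightarrow> list_all (\<lambda>(i, j). i < m \<and> j < m) E"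

definition drawn_edges :: "pattern \<Rightarrow> 'a list \<Rightarrow> 'a set set" where
  "drawn_edges E xs = (\<lambda>(i, j). {xs ! i, xs ! j}) ` set E"

definition embeddings :: "'a ugraph \<Rightarrow> nat \<Rightarrow> pattern \<Rightarrow> 'a list set" where
  "embeddings G m E =
     {xs. length xs = m \<and> distinct xs \<and> set xs \<subseteq> verts G \<and> drawn_edges E xs \<subseteq> edges G}"

definition emb :: "'a ugraph \<Rightarrow> nat \<Rightarrow> pattern \<Rightarrow> nat" where
  "emb G m E = card (embeddings G m E)"

lemma drawn_edges_Nil [simp]: "drawn_edges [] xs = {}"
  by (simp add: drawn_edges_def)

lemma drawn_edges_Cons [simp]:
  "drawn_edges ((i, j) # E) xs = insert {xs ! i, xs ! j} (drawn_edges E xs)"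
  by (simp add: drawn_edges_def)

lemma drawn_edges_append [simp]:
  assumes "wf_pattern (length xs) E"
  shows "drawn_edges E (xs @ ys) = drawn_edges E xs"
  using assms unfolding drawn_edges_def wf_pattern_def list_all_iff
  by (intro image_cong) (auto simp: nth_append)

lemma drawn_edges_map:
  assumes "wf_pattern (length p) E"
  shows "drawn_edges E (map f p) = (`) f ` drawn_edges E p"
  using assms unfolding drawn_edges_def wf_pattern_def list_all_iff image_image
  by (intro image_cong) auto

lemma drawn_edges_via_positions:
  assumes "wf_pattern (length xs) E"
  shows "drawn_edges E xs = (`) ((!) xs) ` drawn_edges E [0..<length xs]"
  using drawn_edges_map[of "[0..<length xs]" E "(!) xs"] assms by (simp add: map_nth)

lemma drawn_edges_subset:
  assumes "wf_pattern (length xs) E" "e \<in> drawn_edges E xs"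
  shows "e \<subseteq> set xs"
  using assms unfolding drawn_edges_def wf_pattern_def list_all_iff by auto

lemma permutation_length:
  "p \<in> permutations_of_set {..<m} \<Longrightarrow> length p = m"
  by (simp add: length_finite_permutations_of_set)

lemma finite_embeddings: "finite (verts G) \<Longrightarrow> finite (embeddings G m E)"
  unfolding embeddings_def
  by (rule finite_subset[OF _ finite_lists_length_eq[of "verts G" m]]) auto

text \<open>Renumbering the vertices of a pattern by a permutation \<open>p\<close> does not change the number of its
  embeddings, since composing embeddings with \<open>p\<close> permutes the injective lists of vertices.\<close>
lemma emb_relabel:
  assumes fin: "finite (verts G)"
    and p: "p \<in> permutations_of_set {..<m}"
    and wf: "wf_pattern m E" "wf_pattern m F"
    and eq: "drawn_edges E p = drawn_edges F [0..<m]"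
  shows "emb G m E = emb G m F"
proof -
  define D where "D = {xs. length xs = m \<and> distinct xs \<and> set xs \<subseteq> verts G}"
  define T where "T = (\<lambda>xs :: 'a list. map ((!) xs) p)"
  have set_p: "set p = {..<m}" and dist_p: "distinct p" and len_p: "length p = m"
    using p by (auto simp: permutations_of_set_def permutation_length)
  have "finite D"
    unfolding D_def by (rule finite_subset[OF _ finite_lists_length_eq[OF fin, of m]]) auto
  moreover have "T ` D \<subseteq> D"
  proof (rule image_subsetI)
    fix xs assume xs: "xs \<in> D"
    hence "set (T xs) = set xs" 
      by (auto simp: T_def D_def set_p set_conv_nth[of xs])
    moreover have "inj_on ((!) xs) (set p)"
      using xs by (auto simp: D_def set_p inj_on_def nth_eq_iff_index_eq)
    ultimately show "T xs \<in> D"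
      using xs by (simp add: D_def T_def distinct_map dist_p len_p)
  qed
  moreover have inj: "inj_on T D"
  proof (rule inj_onI)
    fix xs ys assume "xs \<in> D" "ys \<in> D" "T xs = T ys"
    thus "xs = ys"
      by (intro nth_equalityI) (auto simp: D_def T_def set_p)
  qed
  \<comment> \<open>an injective self-map of a finite set is onto\<close>
  ultimately have surj: "T ` D = D" by (rule endo_inj_surj)
  have edges: "drawn_edges E (T xs) = drawn_edges F xs" if "xs \<in> D" for xs
    using that wf eq drawn_edges_map[of p E "(!) xs"] drawn_edges_via_positions[of xs F]
    by (simp add: D_def T_def len_p)
  have "embeddings G m E = T ` embeddings G m F"
  proof -
    have "embeddings G m E = {xs \<in> T ` D. drawn_edges E xs \<subseteq> edges G}"
      unfolding surj by (auto simp: D_def embeddings_def)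
    also have "\<dots> = T ` {xs \<in> D. drawn_edges F xs \<subseteq> edges G}"
      using edges by auto
    finally show ?thesis by (simp add: D_def embeddings_def conj_ac)
  qed
  moreover have "inj_on T (embeddings G m F)"
    by (rule inj_on_subset[OF inj]) (auto simp: D_def embeddings_def)
  ultimately show ?thesis by (simp add: emb_def card_image)
qed

section \<open>Isomorphism of patterns by computation\<close>

definition joined :: "pattern \<Rightarrow> nat \<Rightarrow> nat \<Rightarrow> bool" where
  "joined E i j \<longleftrightarrow> list_ex (\<lambda>(a, b). a = i \<and> b = j \<or> a = j \<and> b = i) E"

definition pattern_degree :: "pattern \<Rightarrow> nat \<Rightarrow> nat" where
  "pattern_degree E i = length (filter (\<lambda>(a, b). a = i \<or> b = i) E)"

definition carries :: "pattern \<Rightarrow> pattern \<Rightarrow> nat list \<Rightarrow> bool" where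
  "carries E F p \<longleftrightarrow>
     list_all (\<lambda>(a, b). joined F (p ! a) (p ! b)) E \<and>
     list_all (\<lambda>(c, d). list_ex (\<lambda>(a, b). p ! a = c \<and> p ! b = d \<or> p ! a = d \<and> p ! b = c) E) F"

text \<open>Backtracking search for an isomorphism: \<open>p\<close> holds the images of the first vertices, and \<open>r\<close>
  vertices are still to be placed. The degree and adjacency tests only prune the search; what
  makes a positive answer correct is the test \<open>carries\<close> at its leaves.\<close>
fun extends_to_iso :: "nat \<Rightarrow> pattern \<Rightarrow> pattern \<Rightarrow> nat \<Rightarrow> nat list \<Rightarrow> bool" where
  "extends_to_iso m E F 0 p = carries E F p"
| "extends_to_iso m E F (Suc r) p =
     list_ex (\<lambda>j. j \<notin> set p \<and> pattern_degree E (length p) = pattern_degree F j \<and>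
        list_all (\<lambda>(a, b). (a = length p \<and> b < length p \<longrightarrow> joined F j (p ! b)) \<and>
                           (b = length p \<and> a < length p \<longrightarrow> joined F (p ! a) j)) E \<and>
        extends_to_iso m E F r (p @ [j])) [0..<m]"

definition isomorphic :: "nat \<Rightarrow> pattern \<Rightarrow> pattern \<Rightarrow> bool" where
  "isomorphic m E F \<longleftrightarrow>
     length E = length F \<and> wf_pattern m E \<and> wf_pattern m F \<and> extends_to_iso m E F m []"

lemma in_drawn_edges_iff:
  "{u, v} \<in> drawn_edges E xs \<longleftrightarrow>
     (\<exists>(a, b)\<in>set E. xs ! a = u \<and> xs ! b = v \<or> xs ! a = v \<and> xs ! b = u)"
  unfolding drawn_edges_def image_iff by (rule bex_cong[OF refl]) (auto simp: doubleton_eq_iff)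

text \<open>The identity list draws a pattern as itself, so drawn edges can be read off the edge list.\<close>
lemma drawn_edges_joined:
  assumes "wf_pattern m F"
  shows "{i, j} \<in> drawn_edges F [0..<m] \<longleftrightarrow> joined F i j"
  unfolding in_drawn_edges_iff joined_def list_ex_iff
  by (rule bex_cong[OF refl]) (use assms in \<open>auto simp: wf_pattern_def list_all_iff\<close>)

lemma carries_iff:
  assumes "p \<in> permutations_of_set {..<m}" "wf_pattern m E" "wf_pattern m F"
  shows "carries E F p \<longleftrightarrow> drawn_edges E p = drawn_edges F [0..<m]"
proof -
  have p: "length p = m" "set p = {..<m}"
    using assms(1) by (auto simp: permutations_of_set_def permutation_length)
  have lt: "p ! a < m" if "a < m" for a
    using that p nth_mem[of a p] by auto
  have "drawn_edges E p \<subseteq> drawn_edges F [0..<m] \<longleftrightarrow>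
      (\<forall>(a, b)\<in>set E. {p ! a, p ! b} \<in> drawn_edges F [0..<m])"
    unfolding drawn_edges_def[of E] image_subset_iff by (rule ball_cong[OF refl]) auto
  also have "\<dots> \<longleftrightarrow> (\<forall>(a, b)\<in>set E. joined F (p ! a) (p ! b))"
    using assms(2) lt drawn_edges_joined[OF assms(3)]
    by (intro ball_cong refl) (auto simp: wf_pattern_def list_all_iff)
  finally have 1: "drawn_edges E p \<subseteq> drawn_edges F [0..<m] \<longleftrightarrow>
      (\<forall>(a, b)\<in>set E. joined F (p ! a) (p ! b))" .
  have "drawn_edges F [0..<m] = (\<lambda>(c, d). {c, d}) ` set F"
    using assms(3) by (auto simp: drawn_edges_def wf_pattern_def list_all_iff intro!: image_cong)
  hence "drawn_edges F [0..<m] \<subseteq> drawn_edges E p \<longleftrightarrow>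
      (\<forall>(c, d)\<in>set F. {c, d} \<in> drawn_edges E p)"
    by auto
  with 1 show ?thesis
    unfolding carries_def list_all_iff list_ex_iff in_drawn_edges_iff by auto
qed

lemma extends_to_iso_sound:
  assumes "extends_to_iso m E F r p" "distinct p" "set p \<subseteq> {..<m}" "length p + r = m"
  shows "\<exists>q\<in>permutations_of_set {..<m}. carries E F q"
  using assms
proof (induction r arbitrary: p)
  case 0
  hence "set p = {..<m}"
    by (intro card_subset_eq) (auto simp: distinct_card)
  with 0 show ?case by (auto simp: permutations_of_set_def)
next
  case (Suc r)
  then obtain j where "j < m" "j \<notin> set p" "extends_to_iso m E F r (p @ [j])"
    by (auto simp: list_ex_iff)
  with Suc.prems show ?case by (intro Suc.IH[of "p @ [j]"]) auto
qed

lemma emb_isomorphic: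
  assumes "finite (verts G)" "isomorphic m E F"
  shows "emb G m E = emb G m F"
proof -
  have wf: "wf_pattern m E" "wf_pattern m F" and "extends_to_iso m E F m []"
    using assms(2) by (auto simp: isomorphic_def)
  then obtain p where p: "p \<in> permutations_of_set {..<m}" "carries E F p"
    using extends_to_iso_sound[of m E F m "[]"] by auto
  thus ?thesis
    using emb_relabel[OF assms(1) p(1) wf] carries_iff[OF p(1) wf] by blast
qed

text \<open>A certificate that the list \<open>Es\<close> consists of \<open>c\<close> patterns isomorphic to \<open>F\<close> for each entry
  \<open>(c, F)\<close>, where a pattern is counted under the first \<open>F\<close> that fits and none is left over.\<close>
fun census :: "nat \<Rightarrow> pattern list \<Rightarrow> (nat \<times> pattern) list \<Rightarrow> bool" where
  "census m Es [] \<longleftrightarrow> Es = []"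
| "census m Es ((c, F) # ts) \<longleftrightarrow>
     length (filter (\<lambda>E. isomorphic m E F) Es) = c \<and>
     census m (filter (\<lambda>E. \<not> isomorphic m E F) Es) ts"

lemma sum_emb_census:
  assumes "finite (verts G)" "census m Es ts"
  shows "(\<Sum>E\<leftarrow>Es. emb G m E) = (\<Sum>(c, F)\<leftarrow>ts. c * emb G m F)"
  using assms(2)
proof (induction ts arbitrary: Es)
  case Nil
  thus ?case by simp
next
  case (Cons t ts)
  obtain c F where t: "t = (c, F)" by (cases t)
  let ?I = "\<lambda>E. isomorphic m E F"
  have "(\<Sum>E\<leftarrow>Es. emb G m E) =
      (\<Sum>E\<leftarrow>filter ?I Es. emb G m E) + (\<Sum>E\<leftarrow>filter (\<lambda>E. \<not> ?I E) Es. emb G m E)"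
    by (induction Es) auto
  also have "(\<Sum>E\<leftarrow>filter ?I Es. emb G m E) = length (filter ?I Es) * emb G m F"
    by (induction Es) (auto simp: emb_isomorphic[OF assms(1)])
  finally show ?case using Cons by (simp add: t)
qed

text \<open>An edge that is already present must not be listed twice, because the degrees that guide the
  isomorphism search count list entries.\<close>
definition add_edge :: "pattern \<Rightarrow> nat \<Rightarrow> nat \<Rightarrow> pattern" where
  "add_edge E i j = (if joined E i j then E else (i, j) # E)"

text \<open>All ways of joining vertex \<open>w\<close>, respectively any ordered pair of vertices, by an edge.\<close>
definition closures :: "nat \<Rightarrow> pattern \<Rightarrow> nat \<Rightarrow> pattern list" where
  "closures m E w = map (add_edge E w) (filter (\<lambda>j. j \<noteq> w) [0..<m])"

definition all_closures :: "nat \<Rightarrow> pattern \<Rightarrow> pattern list" where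
  "all_closures m E = concat (map (closures m E) [0..<m])"

lemma emb_add_edge: "emb G m (add_edge E i j) = emb G m ((i, j) # E)"
proof -
  have "{xs ! i, xs ! j} \<in> drawn_edges E xs" if "joined E i j" for xs :: "'a list"
    using that by (fastforce simp: joined_def list_ex_iff drawn_edges_def image_iff insert_commute)
  hence "embeddings G m (add_edge E i j) = embeddings G m ((i, j) # E)"
    by (auto simp: embeddings_def add_edge_def)
  thus ?thesis by (simp add: emb_def)
qed

section \<open>Embeddings into regular graphs\<close>

definition neighbours :: "'a ugraph \<Rightarrow> 'a \<Rightarrow> 'a set" where
  "neighbours G v = {u. {v, u} \<in> edges G}"

locale regular_graph =
  fixes G :: "'a ugraph" and d :: nat
  assumes simple: "finite_simple_graph G" and regular: "regular d G"
begin

lemma finite_verts: "finite (verts G)"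
  using simple by (simp add: finite_simple_graph_def)

lemma edge_subset: "e \<in> edges G \<Longrightarrow> e \<subseteq> verts G"
  and edge_card: "e \<in> edges G \<Longrightarrow> card e = 2"
  using simple by (auto simp: finite_simple_graph_def)

lemma no_loop: "{v} \<notin> edges G"
  using edge_card[of "{v}"] by auto

lemma neighbours_subset: "neighbours G v \<subseteq> verts G"
  using edge_subset by (auto simp: neighbours_def)

lemma card_neighbours:
  assumes "v \<in> verts G"
  shows "card (neighbours G v) = d"
proof -
  have "{e \<in> edges G. v \<in> e} = (\<lambda>u. {v, u}) ` neighbours G v"
  proof (intro equalityI subsetI)
    fix e assume e: "e \<in> {e \<in> edges G. v \<in> e}"
    then obtain a b where "e = {a, b}" using edge_card[of e] by (auto simp: card_2_iff)
    with e show "e \<in> (\<lambda>u. {v, u}) ` neighbours G v"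
      by (auto simp: neighbours_def insert_commute)
  qed (auto simp: neighbours_def)
  moreover have "inj_on (\<lambda>u. {v, u}) (neighbours G v)"
    by (auto simp: inj_on_def doubleton_eq_iff)
  ultimately have "card {e \<in> edges G. v \<in> e} = card (neighbours G v)"
    by (simp only: card_image)
  thus ?thesis
    using regular assms by (simp add: regular_def vertex_degree_def)
qed

text \<open>Splitting off the image of the last vertex: if the edges at that vertex say exactly that its
  image lies in \<open>A xs\<close>, then it can be chosen freely in \<open>A xs\<close> outside the vertices already used.\<close>
lemma emb_extend:
  assumes F: "\<And>xs y. length xs = m \<Longrightarrow> drawn_edges F (xs @ [y]) \<subseteq> edges G \<and> y \<in> verts G \<longleftrightarrow>
              drawn_edges E xs \<subseteq> edges G \<and> y \<in> A xs"
    and A: "\<And>xs. A xs \<subseteq> verts G"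
  shows "emb G (Suc m) F = (\<Sum>xs\<in>embeddings G m E. card (A xs - set xs))"
proof -
  let ?S = "SIGMA xs:embeddings G m E. A xs - set xs"
  have "embeddings G (Suc m) F = (\<lambda>(xs, y). xs @ [y]) ` ?S"
  proof (intro equalityI subsetI)
    fix zs assume zs: "zs \<in> embeddings G (Suc m) F"
    then obtain xs y where xs: "zs = xs @ [y]" "length xs = m"
      by (cases zs rule: rev_cases) (auto simp: embeddings_def)
    with zs F[of xs y] have "(xs, y) \<in> ?S" by (auto simp: embeddings_def)
    with xs show "zs \<in> (\<lambda>(xs, y). xs @ [y]) ` ?S" by force
  next
    fix zs assume "zs \<in> (\<lambda>(xs, y). xs @ [y]) ` ?S"
    then obtain xs y where xs: "zs = xs @ [y]" "xs \<in> embeddings G m E" "y \<in> A xs - set xs"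
      by auto
    with F[of xs y] A[of xs] show "zs \<in> embeddings G (Suc m) F" by (auto simp: embeddings_def)
  qed
  moreover have "inj_on (\<lambda>(xs, y). xs @ [y]) ?S" by (auto simp: inj_on_def)
  moreover have "finite (A xs - set xs)" for xs
    using A finite_verts by (meson finite_Diff finite_subset)
  ultimately show ?thesis
    by (simp add: emb_def card_image card_SigmaI finite_embeddings[OF finite_verts])
qed

lemma emb_isolated:
  assumes "wf_pattern m E"
  shows "emb G (Suc m) E = (card (verts G) - m) * emb G m E"
proof -
  have "emb G (Suc m) E = (\<Sum>xs\<in>embeddings G m E. card (verts G - set xs))"
    using simple assms by (intro emb_extend) (auto simp: finite_simple_graph_def)
  also have "\<dots> = (\<Sum>xs\<in>embeddings G m E. card (verts G) - m)"
    by (intro sum.cong refl) (auto simp: embeddings_def card_Diff_subset distinct_card)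
  finally show ?thesis by (simp add: emb_def)
qed

text \<open>The reduction that drives the proof. The image of \<open>w\<close> has \<open>d\<close> neighbours; each of them either is
  unused, and can serve as the image of the pendant vertex \<open>m\<close>, or is the image of some \<open>j < m\<close>, and
  then the embedding also draws the edge from \<open>w\<close> to \<open>j\<close>.\<close>
lemma emb_pendant:
  assumes wf: "wf_pattern m E" and w: "w < m"
  shows "emb G (Suc m) ((w, m) # E) + (\<Sum>j<m. emb G m ((w, j) # E)) = d * emb G m E"
proof -
  let ?N = "\<lambda>xs. neighbours G (xs ! w)"
  let ?X = "embeddings G m E"
  have fin: "finite (?N xs)" for xs :: "'a list"
    using neighbours_subset finite_verts by (meson finite_subset)
  have "emb G (Suc m) ((w, m) # E) = (\<Sum>xs\<in>?X. card (?N xs - set xs))"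
    by (rule emb_extend)
       (use wf w neighbours_subset in \<open>auto simp: nth_append neighbours_def\<close>)
  moreover have "(\<Sum>j<m. emb G m ((w, j) # E)) = (\<Sum>xs\<in>?X. card (?N xs \<inter> set xs))"
  proof -
    have "emb G m ((w, j) # E) = (\<Sum>xs\<in>?X. if xs ! j \<in> ?N xs then 1 else 0)" for j
    proof -
      have "embeddings G m ((w, j) # E) = ?X \<inter> {xs. xs ! j \<in> ?N xs}"
        by (auto simp: embeddings_def neighbours_def)
      thus ?thesis
        by (simp add: emb_def sum.If_cases finite_embeddings[OF finite_verts])
    qed
    hence "(\<Sum>j<m. emb G m ((w, j) # E)) = (\<Sum>xs\<in>?X. \<Sum>j<m. if xs ! j \<in> ?N xs then 1 else 0)"
      by (simp add: sum.swap[of _ "{..<m}"])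
    also have "\<dots> = (\<Sum>xs\<in>?X. card (?N xs \<inter> set xs))"
    proof (rule sum.cong[OF refl])
      fix xs assume "xs \<in> ?X"
      hence xs: "length xs = m" "distinct xs" by (auto simp: embeddings_def)
      have "?N xs \<inter> set xs = (!) xs ` ({..<m} \<inter> {j. xs ! j \<in> ?N xs})"
        using xs by (auto simp: set_conv_nth)
      moreover have "inj_on ((!) xs) ({..<m} \<inter> {j. xs ! j \<in> ?N xs})"
        using xs by (auto simp: inj_on_def nth_eq_iff_index_eq)
      ultimately show "(\<Sum>j<m. if xs ! j \<in> ?N xs then 1 else 0) = card (?N xs \<inter> set xs)"
        by (simp add: card_image sum.If_cases)
    qed
    finally show ?thesis .
  qed
  moreover have "card (?N xs - set xs) + card (?N xs \<inter> set xs) = d" if "xs \<in> ?X" for xs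
  proof -
    have "xs ! w \<in> verts G" using that w nth_mem[of w xs] by (auto simp: embeddings_def)
    hence "card (?N xs) = d" by (rule card_neighbours)
    thus ?thesis
      using card_Int_Diff[OF fin, of xs "set xs"] by simp
  qed
  ultimately show ?thesis
    by (simp add: sum.distrib[symmetric] emb_def)
qed

end

lemma sum_list_concat: "sum_list (concat xss) = (\<Sum>xs\<leftarrow>xss. sum_list xs)"
  for xss :: "nat list list"
  by (induction xss) auto

context regular_graph
begin

lemma emb_loop: "emb G m ((i, i) # E) = 0"
  using no_loop by (simp add: emb_def embeddings_def)

lemma sum_closures:
  "(\<Sum>F\<leftarrow>closures m E w. emb G m F) = (\<Sum>j<m. emb G m ((w, j) # E))"
proof -
  have "(\<Sum>F\<leftarrow>closures m E w. emb G m F) = (\<Sum>j\<leftarrow>filter (\<lambda>j. j \<noteq> w) [0..<m]. emb G m ((w, j) # E))"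
    by (simp add: closures_def emb_add_edge o_def)
  also have "\<dots> = (\<Sum>j\<leftarrow>[0..<m]. emb G m ((w, j) # E))"
    by (rule sum_list_map_filter) (auto simp: emb_loop)
  also have "\<dots> = (\<Sum>j<m. emb G m ((w, j) # E))"
    by (simp add: interv_sum_list_conv_sum_set_nat atLeast0LessThan)
  finally show ?thesis .
qed

text \<open>The two reductions in the form in which they are used: the patterns on the right-hand side are
  collected into isomorphism classes, and all premises can be decided by computation.\<close>
lemma emb_pendant_census:
  assumes "n = Suc m" "w < m" "wf_pattern m E" "isomorphic n F ((w, m) # E)"
    and "census m (closures m E w) ts"
  shows "emb G n F + (\<Sum>(c, H)\<leftarrow>ts. c * emb G m H) = d * emb G m E"
  using emb_pendant[OF assms(3,2)] emb_isomorphic[OF finite_verts assms(4)]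
    sum_emb_census[OF finite_verts assms(5)] assms(1)
  by (simp add: sum_closures)

lemma emb_swap: "emb G m ((i, j) # E) = emb G m ((j, i) # E)"
  by (simp add: emb_def embeddings_def insert_commute)

text \<open>Counting the ways to add a disjoint edge: from the \<open>card (verts G) * d\<close> ordered edges of \<open>G\<close>, the
  \<open>m * d\<close> that start in a used vertex and the \<open>m * d\<close> that end in one are subtracted; those with both
  ends used, which the double sum counts, have then been subtracted twice. The proof
  obtains this by removing the two ends of the new edge one after the other.\<close>
lemma emb_far_edge:
  assumes wf: "wf_pattern m E"
  shows "emb G (Suc (Suc m)) ((m, Suc m) # E) + 2 * m * d * emb G m E =
      card (verts G) * d * emb G m E + (\<Sum>i<m. \<Sum>j<m. emb G m ((i, j) # E))"
proof (cases "m \<le> card (verts G)")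
  case True
  have wf': "wf_pattern (Suc m) E"
    using wf by (auto simp: wf_pattern_def list_all_iff)
  \<comment> \<open>vertex \<open>Suc m\<close> is pendant at \<open>m\<close>, which is isolated once \<open>Suc m\<close> is removed\<close>
  have "emb G (Suc (Suc m)) ((m, Suc m) # E) + (\<Sum>j<m. emb G (Suc m) ((j, m) # E))
      = d * emb G (Suc m) E"
    using emb_pendant[OF wf', of m] by (simp add: emb_loop emb_swap[of _ m])
  also have "\<dots> = d * (card (verts G) - m) * emb G m E"
    by (simp add: emb_isolated[OF wf])
  finally have 1: "emb G (Suc (Suc m)) ((m, Suc m) # E) + (\<Sum>j<m. emb G (Suc m) ((j, m) # E))
      = d * (card (verts G) - m) * emb G m E" .
  \<comment> \<open>joined to a used vertex \<open>j\<close> instead, \<open>m\<close> is itself pendant\<close>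
  have "(\<Sum>j<m. emb G (Suc m) ((j, m) # E) + (\<Sum>i<m. emb G m ((j, i) # E)))
      = (\<Sum>j<m. d * emb G m E)"
    by (intro sum.cong refl emb_pendant[OF wf]) simp
  hence 2: "(\<Sum>j<m. emb G (Suc m) ((j, m) # E)) + (\<Sum>j<m. \<Sum>i<m. emb G m ((j, i) # E))
      = m * d * emb G m E"
    by (simp add: sum.distrib)
  have "d * (card (verts G) - m) * emb G m E + m * d * emb G m E = card (verts G) * d * emb G m E"
    using True by (simp add: algebra_simps diff_mult_distrib diff_mult_distrib2 flip: add_mult_distrib)
  with 1 2 show ?thesis by linarith
next
  case False
  \<comment> \<open>More than \<open>card (verts G)\<close> vertices cannot be embedded; this case is separate because
    the number of choices for an isolated vertex is a truncated difference.\<close>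
  have zero: "emb G k F = 0" if "k \<ge> m" for k F
  proof -
    have "length xs \<le> card (verts G)" if "xs \<in> embeddings G k F" for xs
      using that card_mono[OF finite_verts, of "set xs"]
      by (simp add: embeddings_def distinct_card)
    with that False have "embeddings G k F = {}"
      by (fastforce simp: embeddings_def)
    thus ?thesis by (simp add: emb_def)
  qed
  show ?thesis by (simp add: zero)
qed

lemma emb_far_edge_census:
  assumes "n = Suc (Suc m)" "wf_pattern m E" "isomorphic n F ((m, Suc m) # E)"
    and "census m (all_closures m E) ts"
  shows "emb G n F + 2 * m * d * emb G m E =
      card (verts G) * d * emb G m E + (\<Sum>(c, H)\<leftarrow>ts. c * emb G m H)"
proof -
  have "(\<Sum>(c, H)\<leftarrow>ts. c * emb G m H) = (\<Sum>i\<leftarrow>[0..<m]. \<Sum>H\<leftarrow>closures m E i. emb G m H)"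
    unfolding sum_emb_census[OF finite_verts assms(4), symmetric] all_closures_def
    by (simp only: map_concat map_map o_def sum_list_concat)
  also have "\<dots> = (\<Sum>i<m. \<Sum>j<m. emb G m ((i, j) # E))"
    by (simp add: sum_closures interv_sum_list_conv_sum_set_nat atLeast0LessThan)
  finally show ?thesis
    using emb_far_edge[OF assms(2)] emb_isomorphic[OF finite_verts assms(3)] assms(1) by simp
qed

end

section \<open>The linear relations between the patterns with at most five edges\<close>

definition matching_pattern :: "nat \<Rightarrow> pattern" where
  "matching_pattern k = map (\<lambda>i. (2 * i, 2 * i + 1)) [0..<k]"

definition path_pattern :: "nat \<Rightarrow> pattern" where
  "path_pattern k = map (\<lambda>i. (i, Suc i)) [0..<k - 1]"

definition cycle_pattern :: "nat \<Rightarrow> pattern" where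
  "cycle_pattern k = map (\<lambda>i. (i, Suc i mod k)) [0..<k]"

text \<open>The numbering makes the missing edge of \<open>K\<^sub>4\<close> the pair \<open>{0, 1}\<close>, as in \<open>Q_graph\<close>.\<close>
definition diamond :: pattern where
  "diamond = [(0, 2), (0, 3), (1, 2), (1, 3), (2, 3)]"

text \<open>A \<open>k\<close>-matching two of whose edges are linked by a further edge, that is, a path on four
  vertices together with \<open>k - 2\<close> disjoint edges.\<close>
definition bridged_matching :: "nat \<Rightarrow> pattern" where
  "bridged_matching k = (1, 2) # matching_pattern k"

text \<open>A triangle with a tail of length one (paw) or two (lollipop) or with two pendant vertices at
  different corners (bull), a four-cycle with a pendant vertex (banner), and the trees that
  consist of three legs of lengths \<open>1, 1, 2\<close> (chair) or \<open>1, 2, 2\<close> (spider).\<close>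
definition paw :: pattern where
  "paw = (0, 3) # cycle_pattern 3"

definition lollipop :: pattern where
  "lollipop = (3, 4) # paw"

definition bull :: pattern where
  "bull = (1, 4) # paw"

definition banner :: pattern where
  "banner = (0, 4) # cycle_pattern 4"

definition chair :: pattern where
  "chair = (1, 4) # path_pattern 4"

definition spider :: pattern where
  "spider = (4, 5) # chair"

text \<open>Disjoint unions with a single edge.\<close>
definition square_edge :: pattern where
  "square_edge = (4, 5) # cycle_pattern 4"

definition paw_edge :: pattern where
  "paw_edge = (4, 5) # paw"

context regular_graph
begin

text \<open>Each relation removes a pendant vertex or a disjoint edge. The patterns that this produces have
  fewer vertices and no more edges than the reduced one, so the recursion ends in the three
  cycles and the diamond.\<close>
lemma emb_path3:
  "emb G 3 (path_pattern 3) + emb G 2 (path_pattern 2) = d * emb G 2 (path_pattern 2)"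
proof -
  have "wf_pattern 2 (path_pattern 2)"
    and "isomorphic 3 (path_pattern 3) ((1, 2) # path_pattern 2)"
    and "census 2 (closures 2 (path_pattern 2) 1) [(1, path_pattern 2)]"
    by code_simp+
  from emb_pendant_census[OF _ _ this] show ?thesis by simp
qed

lemma emb_path4:
  "emb G 4 (path_pattern 4) + emb G 3 (cycle_pattern 3) + emb G 3 (path_pattern 3) = d * emb G 3 (path_pattern 3)"
proof -
  have "wf_pattern 3 (path_pattern 3)"
    and "isomorphic 4 (path_pattern 4) ((2, 3) # path_pattern 3)"
    and "census 3 (closures 3 (path_pattern 3) 2) [(1, cycle_pattern 3), (1, path_pattern 3)]"
    by code_simp+
  from emb_pendant_census[OF _ _ this] show ?thesis by simp
qed

lemma emb_path5:
  "emb G 5 (path_pattern 5) + emb G 4 (cycle_pattern 4) + emb G 4 paw + emb G 4 (path_pattern 4) = d * emb G 4 (path_pattern 4)"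
proof -
  have "wf_pattern 4 (path_pattern 4)"
    and "isomorphic 5 (path_pattern 5) ((3, 4) # path_pattern 4)"
    and "census 4 (closures 4 (path_pattern 4) 3) [(1, cycle_pattern 4), (1, paw), (1, path_pattern 4)]"
    by code_simp+
  from emb_pendant_census[OF _ _ this] show ?thesis by simp
qed

lemma emb_path6:
  "emb G 6 (path_pattern 6) + emb G 5 (cycle_pattern 5) + emb G 5 banner + emb G 5 lollipop + emb G 5 (path_pattern 5) = d * emb G 5 (path_pattern 5)"
proof -
  have "wf_pattern 5 (path_pattern 5)"
    and "isomorphic 6 (path_pattern 6) ((4, 5) # path_pattern 5)"
    and "census 5 (closures 5 (path_pattern 5) 4) [(1, cycle_pattern 5), (1, banner), (1, lollipop), (1, path_pattern 5)]"
    by code_simp+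
  from emb_pendant_census[OF _ _ this] show ?thesis by simp
qed

lemma emb_chair:
  "emb G 5 chair + emb G 4 paw + 2 * emb G 4 (path_pattern 4) = d * emb G 4 (path_pattern 4)"
proof -
  have "wf_pattern 4 (path_pattern 4)"
    and "isomorphic 5 chair ((1, 4) # path_pattern 4)"
    and "census 4 (closures 4 (path_pattern 4) 1) [(1, paw), (2, path_pattern 4)]"
    by code_simp+
  from emb_pendant_census[OF _ _ this] show ?thesis by simp
qed

lemma emb_spider:
  "emb G 6 spider + emb G 5 lollipop + emb G 5 bull + emb G 5 banner + emb G 5 chair = d * emb G 5 chair"
proof -
  have "wf_pattern 5 chair"
    and "isomorphic 6 spider ((4, 5) # chair)"
    and "census 5 (closures 5 chair 4) [(1, lollipop), (1, bull), (1, banner), (1, chair)]"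
    by code_simp+
  from emb_pendant_census[OF _ _ this] show ?thesis by simp
qed

lemma emb_paw:
  "emb G 4 paw + 2 * emb G 3 (cycle_pattern 3) = d * emb G 3 (cycle_pattern 3)"
proof -
  have "wf_pattern 3 (cycle_pattern 3)"
    and "isomorphic 4 paw ((0, 3) # cycle_pattern 3)"
    and "census 3 (closures 3 (cycle_pattern 3) 0) [(2, cycle_pattern 3)]"
    by code_simp+
  from emb_pendant_census[OF _ _ this] show ?thesis by simp
qed

lemma emb_banner:
  "emb G 5 banner + emb G 4 diamond + 2 * emb G 4 (cycle_pattern 4) = d * emb G 4 (cycle_pattern 4)"
proof -
  have "wf_pattern 4 (cycle_pattern 4)"
    and "isomorphic 5 banner ((0, 4) # cycle_pattern 4)"
    and "census 4 (closures 4 (cycle_pattern 4) 0) [(1, diamond), (2, cycle_pattern 4)]"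
    by code_simp+
  from emb_pendant_census[OF _ _ this] show ?thesis by simp
qed

lemma emb_lollipop:
  "emb G 5 lollipop + 2 * emb G 4 diamond + emb G 4 paw = d * emb G 4 paw"
proof -
  have "wf_pattern 4 paw"
    and "isomorphic 5 lollipop ((3, 4) # paw)"
    and "census 4 (closures 4 paw 3) [(2, diamond), (1, paw)]"
    by code_simp+
  from emb_pendant_census[OF _ _ this] show ?thesis by simp
qed

lemma emb_bull:
  "emb G 5 bull + emb G 4 diamond + 2 * emb G 4 paw = d * emb G 4 paw"
proof -
  have "wf_pattern 4 paw"
    and "isomorphic 5 bull ((1, 4) # paw)"
    and "census 4 (closures 4 paw 1) [(1, diamond), (2, paw)]"
    by code_simp+
  from emb_pendant_census[OF _ _ this] show ?thesis by simp
qed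

lemma emb_square_edge:
  "emb G 6 square_edge + 8 * d * emb G 4 (cycle_pattern 4) =
    card (verts G) * d * emb G 4 (cycle_pattern 4) + 4 * emb G 4 diamond + 8 * emb G 4 (cycle_pattern 4)"
proof -
  have "wf_pattern 4 (cycle_pattern 4)"
    and "isomorphic 6 square_edge ((4, Suc 4) # cycle_pattern 4)"
    and "census 4 (all_closures 4 (cycle_pattern 4)) [(4, diamond), (8, cycle_pattern 4)]"
    by code_simp+
  from emb_far_edge_census[OF _ this] show ?thesis by simp
qed

lemma emb_paw_edge:
  "emb G 6 paw_edge + 8 * d * emb G 4 paw =
    card (verts G) * d * emb G 4 paw + 4 * emb G 4 diamond + 8 * emb G 4 paw"
proof -
  have "wf_pattern 4 paw"
    and "isomorphic 6 paw_edge ((4, Suc 4) # paw)"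
    and "census 4 (all_closures 4 paw) [(4, diamond), (8, paw)]"
    by code_simp+
  from emb_far_edge_census[OF _ this] show ?thesis by simp
qed

lemma emb_bridged_matching3:
  "emb G 6 (bridged_matching 3) + 8 * d * emb G 4 (bridged_matching 2) =
    card (verts G) * d * emb G 4 (bridged_matching 2) + 4 * emb G 4 paw + 2 * emb G 4 (cycle_pattern 4) + 6 * emb G 4 (bridged_matching 2)"
proof -
  have "wf_pattern 4 (bridged_matching 2)"
    and "isomorphic 6 (bridged_matching 3) ((4, Suc 4) # bridged_matching 2)"
    and "census 4 (all_closures 4 (bridged_matching 2)) [(4, paw), (2, cycle_pattern 4), (6, bridged_matching 2)]"
    by code_simp+
  from emb_far_edge_census[OF _ this] show ?thesis by simp
qed

text \<open>The chords of the path give the paw and the four-cycle, each with a disjoint edge. Of the 16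
  ordered pairs between the path and the disjoint edge, the 8 that use an end of the path give a path on six vertices, and the
  8 that use an inner vertex give a spider.\<close>
lemma emb_bridged_matching4:
  "emb G 8 (bridged_matching 4) + 12 * d * emb G 6 (bridged_matching 3) =
    card (verts G) * d * emb G 6 (bridged_matching 3) + 4 * emb G 6 paw_edge + 2 * emb G 6 square_edge + 8 * emb G 6 (path_pattern 6) + 8 * emb G 6 spider + 8 * emb G 6 (bridged_matching 3)"
proof -
  have "wf_pattern 6 (bridged_matching 3)"
    and "isomorphic 8 (bridged_matching 4) ((6, Suc 6) # bridged_matching 3)"
    and "census 6 (all_closures 6 (bridged_matching 3)) [(4, paw_edge), (2, square_edge), (8, path_pattern 6), (8, spider), (8, bridged_matching 3)]"
    by code_simp+
  from emb_far_edge_census[OF _ this] show ?thesis by simp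
qed

lemma emb_matching1:
  "emb G 2 (matching_pattern 1) =
    card (verts G) * d * emb G 0 []"
proof -
  have "wf_pattern 0 []"
    and "isomorphic 2 (matching_pattern 1) ((0, Suc 0) # [])"
    and "census 0 (all_closures 0 []) []"
    by code_simp+
  from emb_far_edge_census[OF _ this] show ?thesis by simp
qed

text \<open>Of the ordered pairs of vertices of a \<open>k\<close>-matching, \<open>2 * k\<close> form an edge of it, and the remaining
  \<open>4 * k * (k - 1)\<close> link two of its edges.\<close>
lemma emb_matching2:
  "emb G 4 (matching_pattern 2) + 4 * d * emb G 2 (matching_pattern 1) =
    card (verts G) * d * emb G 2 (matching_pattern 1) + 2 * emb G 2 (matching_pattern 1)"
proof -
  have "wf_pattern 2 (matching_pattern 1)"
    and "isomorphic 4 (matching_pattern 2) ((2, Suc 2) # matching_pattern 1)"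
    and "census 2 (all_closures 2 (matching_pattern 1)) [(2, matching_pattern 1)]"
    by code_simp+
  from emb_far_edge_census[OF _ this] show ?thesis by simp
qed

lemma emb_matching3:
  "emb G 6 (matching_pattern 3) + 8 * d * emb G 4 (matching_pattern 2) =
    card (verts G) * d * emb G 4 (matching_pattern 2) + 8 * emb G 4 (bridged_matching 2) + 4 * emb G 4 (matching_pattern 2)"
proof -
  have "wf_pattern 4 (matching_pattern 2)"
    and "isomorphic 6 (matching_pattern 3) ((4, Suc 4) # matching_pattern 2)"
    and "census 4 (all_closures 4 (matching_pattern 2)) [(8, bridged_matching 2), (4, matching_pattern 2)]"
    by code_simp+
  from emb_far_edge_census[OF _ this] show ?thesis by simp
qed

lemma emb_matching4:
  "emb G 8 (matching_pattern 4) + 12 * d * emb G 6 (matching_pattern 3) =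
    card (verts G) * d * emb G 6 (matching_pattern 3) + 24 * emb G 6 (bridged_matching 3) + 6 * emb G 6 (matching_pattern 3)"
proof -
  have "wf_pattern 6 (matching_pattern 3)"
    and "isomorphic 8 (matching_pattern 4) ((6, Suc 6) # matching_pattern 3)"
    and "census 6 (all_closures 6 (matching_pattern 3)) [(24, bridged_matching 3), (6, matching_pattern 3)]"
    by code_simp+
  from emb_far_edge_census[OF _ this] show ?thesis by simp
qed

lemma emb_matching5:
  "emb G 10 (matching_pattern 5) + 16 * d * emb G 8 (matching_pattern 4) =
    card (verts G) * d * emb G 8 (matching_pattern 4) + 48 * emb G 8 (bridged_matching 4) + 8 * emb G 8 (matching_pattern 4)"
proof -
  have "wf_pattern 8 (matching_pattern 4)"
    and "isomorphic 10 (matching_pattern 5) ((8, Suc 8) # matching_pattern 4)"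
    and "census 8 (all_closures 8 (matching_pattern 4)) [(48, bridged_matching 4), (8, matching_pattern 4)]"
    by code_simp+
  from emb_far_edge_census[OF _ this] show ?thesis by simp
qed

end

section \<open>From embeddings to subgraphs\<close>

definition automorphisms :: "nat \<Rightarrow> pattern \<Rightarrow> nat list set" where
  "automorphisms m E =
     {p \<in> permutations_of_set {..<m}. drawn_edges E p = drawn_edges E [0..<m]}"

lemma card_automorphisms:
  assumes "wf_pattern m E"
  shows "card (automorphisms m E) = length (filter (carries E E) (permutations_of_set_list [0..<m]))"
proof -
  have perms: "permutations_of_set {..<m} = set (permutations_of_set_list [0..<m])"
    using permutations_of_list[of "[0..<m]"] by (simp add: atLeast0LessThan)
  hence "automorphisms m E = set (filter (carries E E) (permutations_of_set_list [0..<m]))"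
    using carries_iff[OF _ assms assms] by (auto simp: automorphisms_def)
  moreover have "distinct (filter (carries E E) (permutations_of_set_list [0..<m]))"
    by (simp add: distinct_permutations_of_set_list)
  ultimately show ?thesis by (simp only: distinct_card)
qed

lemma nth_image_all: "length xs = m \<Longrightarrow> (!) xs ` {..<m} = set xs"
  by (auto simp: set_conv_nth)

text \<open>Two drawings of a pattern with the same edges differ by an automorphism of the pattern. The
  pattern must cover its vertices, for otherwise the edges do not determine which vertices are used.\<close>
lemma card_drawings:
  assumes wf: "wf_pattern m E" and cover: "\<Union> (drawn_edges E [0..<m]) = {..<m}"
    and zs: "length zs = m" "distinct zs"
  shows "card {xs. length xs = m \<and> distinct xs \<and> drawn_edges E xs = drawn_edges E zs}
     = card (automorphisms m E)"
proof -
  let ?D = "drawn_edges E [0..<m]"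
  let ?L = "{xs. length xs = m \<and> distinct xs \<and> drawn_edges E xs = drawn_edges E zs}"
  have drawn: "drawn_edges E xs = (`) ((!) xs) ` ?D" if "length xs = m" for xs :: "'a list"
    using drawn_edges_via_positions[of xs E] wf that by simp
  have union: "\<Union> (drawn_edges E xs) = set xs" if "length xs = m" for xs :: "'a list"
    using nth_image_all[OF that] cover by (simp add: drawn[OF that] flip: image_Union)
  have inj: "inj_on ((!) zs) {..<m}"
    using zs by (auto simp: inj_on_def nth_eq_iff_index_eq)
  have drawn_map: "drawn_edges E (map ((!) zs) p) = (`) ((!) zs) ` drawn_edges E p"
    if "length p = m" for p
    using drawn_edges_map[of p E] wf that by simp
  have "?L = map ((!) zs) ` automorphisms m E"
  proof (intro equalityI subsetI)
    fix xs assume xs: "xs \<in> ?L"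
    hence same: "set xs = (!) zs ` {..<m}"
      using union[of xs] union[of zs] nth_image_all[OF zs(1)] zs(1) by simp
    define p where "p = map (inv_into {..<m} ((!) zs)) xs"
    have p_lt: "set p \<subseteq> {..<m}"
      unfolding p_def set_map same by (intro image_subsetI inv_into_into)
    have map_p: "map ((!) zs) p = xs"
      unfolding p_def map_map
      by (rule map_idI) (use same in \<open>simp add: f_inv_into_f\<close>)
    have "distinct p"
      using xs map_p distinct_map[of "(!) zs" p] by simp
    moreover have len: "length p = m" using xs by (simp add: p_def)
    ultimately have perm: "p \<in> permutations_of_set {..<m}"
      using p_lt card_subset_eq[of "{..<m}" "set p"] by (simp add: permutations_of_set_def distinct_card)
    have "(`) ((!) zs) ` drawn_edges E p = (`) ((!) zs) ` ?D"
      using drawn_map[OF len] map_p xs drawn[OF zs(1)] by simp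
    moreover have "drawn_edges E p \<subseteq> Pow {..<m}"
      using drawn_edges_subset[of p E] wf len p_lt by auto
    moreover have "?D \<subseteq> Pow {..<m}" using cover by auto
    ultimately have "drawn_edges E p = ?D"
      by (simp only: inj_on_image_eq_iff[OF inj_on_image_Pow[OF inj]])
    with perm have "p \<in> automorphisms m E" by (simp add: automorphisms_def)
    thus "xs \<in> map ((!) zs) ` automorphisms m E" using map_p by (metis imageI)
  next
    fix xs assume "xs \<in> map ((!) zs) ` automorphisms m E"
    then obtain p where p: "p \<in> permutations_of_set {..<m}" "drawn_edges E p = ?D"
      and xs: "xs = map ((!) zs) p"
      by (auto simp: automorphisms_def)
    have len: "length p = m" and "distinct p" "set p = {..<m}"
      using p by (auto simp: permutations_of_set_def permutation_length)
    hence "distinct xs" using inj by (simp add: xs distinct_map)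
    moreover have "drawn_edges E xs = drawn_edges E zs"
      unfolding xs drawn_map[OF len] p(2) drawn[OF zs(1)] ..
    ultimately show "xs \<in> ?L" using len by (simp add: xs)
  qed
  moreover have "inj_on (map ((!) zs)) (automorphisms m E)"
  proof (rule inj_onI)
    fix p q assume pq: "p \<in> automorphisms m E" "q \<in> automorphisms m E"
      and eq: "map ((!) zs) p = map ((!) zs) q"
    hence "set p = {..<m}" "set q = {..<m}"
      by (auto simp: automorphisms_def permutations_of_set_def)
    with eq inj show "p = q" by (intro map_inj_on[OF eq]) simp
  qed
  ultimately show ?thesis by (simp add: card_image)
qed

text \<open>A set of edges is a copy of a pattern if and only if some list draws it; the list consists of
  the preimages of \<open>0, \<dots>, m - 1\<close> under the isomorphism.\<close>
lemma graph_iso_pattern_iff: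
  assumes wf: "wf_pattern m E" and cover: "\<Union> (drawn_edges E [0..<m]) = {..<m}"
  shows "graph_iso (\<Union>F, F) ({..<m}, drawn_edges E [0..<m]) \<longleftrightarrow>
     (\<exists>xs. length xs = m \<and> distinct xs \<and> drawn_edges E xs = F)" (is "?iso \<longleftrightarrow> ?drawn")
proof
  let ?D = "drawn_edges E [0..<m]"
  assume ?iso
  then obtain f where f: "bij_betw f (\<Union>F) {..<m}" "?D = (`) f ` F"
    by (auto simp: graph_iso_def)
  define g where "g = inv_into (\<Union>F) f"
  have g: "bij_betw g {..<m} (\<Union>F)"
    unfolding g_def by (rule bij_betw_inv_into[OF f(1)])
  have "g ` f ` e = e" if "e \<in> F" for e
    using that f(1) unfolding g_def bij_betw_def by (intro inv_into_image_cancel) auto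
  hence "(`) g ` ?D = F"
    unfolding f(2) image_image by simp
  hence "drawn_edges E (map g [0..<m]) = F"
    using drawn_edges_map[of "[0..<m]" E g] wf by simp
  moreover have "distinct (map g [0..<m])"
    using g by (simp add: distinct_map bij_betw_def atLeast0LessThan)
  ultimately show ?drawn by (intro exI[of _ "map g [0..<m]"]) simp
next
  let ?D = "drawn_edges E [0..<m]"
  assume ?drawn
  then obtain xs where xs: "length xs = m" "distinct xs" and F: "drawn_edges E xs = F" by blast
  have drawn: "F = (`) ((!) xs) ` ?D"
    using drawn_edges_via_positions[of xs E] wf xs F by simp
  have union: "\<Union>F = (!) xs ` {..<m}"
    unfolding drawn using cover by (simp flip: image_Union)
  have inj: "inj_on ((!) xs) {..<m}"
    using xs by (auto simp: inj_on_def nth_eq_iff_index_eq)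
  define f where "f = inv_into {..<m} ((!) xs)"
  have "bij_betw f (\<Union>F) {..<m}"
    unfolding f_def union by (intro bij_betw_inv_into inj_on_imp_bij_betw inj)
  moreover have "f ` (!) xs ` e = e" if "e \<in> ?D" for e
    unfolding f_def using that cover by (intro inv_into_image_cancel[OF inj]) auto
  hence "(`) f ` F = ?D"
    unfolding drawn image_image by simp
  ultimately show ?iso by (auto simp: graph_iso_def)
qed

text \<open>The embeddings are sorted by the subgraph that they draw; each subgraph is drawn once for every
  automorphism.\<close>
lemma emb_eq_automorphisms_times_subgraphs:
  assumes G: "finite_simple_graph G"
    and wf: "wf_pattern m E" and cover: "\<Union> (drawn_edges E [0..<m]) = {..<m}"
  shows "emb G m E =
     card (automorphisms m E) * num_subgraphs ({..<m}, drawn_edges E [0..<m]) G"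
proof -
  let ?C = "{F. F \<subseteq> edges G \<and> graph_iso (\<Union>F, F) ({..<m}, drawn_edges E [0..<m])}"
  let ?L = "\<lambda>F. {xs. length xs = m \<and> distinct xs \<and> drawn_edges E xs = F}"
  have fin: "finite (verts G)" using G by (simp add: finite_simple_graph_def)
  have "finite (edges G)"
    using G by (intro finite_subset[of "edges G" "Pow (verts G)"])
      (auto simp: finite_simple_graph_def)
  hence finC: "finite ?C" by (intro finite_subset[of ?C "Pow (edges G)"]) auto
  have "set xs \<subseteq> verts G" if "length xs = m" "drawn_edges E xs \<subseteq> edges G" for xs
  proof -
    have "set xs = \<Union> (drawn_edges E xs)"
      using drawn_edges_via_positions[of xs E] wf cover nth_image_all[OF that(1)] that(1)
      by (simp flip: image_Union)
    thus ?thesis using that(2) G by (auto simp: finite_simple_graph_def)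
  qed
  hence emb: "embeddings G m E = (\<Union>F\<in>?C. ?L F)"
    unfolding graph_iso_pattern_iff[OF wf cover] embeddings_def by blast
  have card_L: "card (?L F) = card (automorphisms m E)" if "F \<in> ?C" for F
    using that card_drawings[OF wf cover] unfolding graph_iso_pattern_iff[OF wf cover] by blast
  have "finite (?L F)" if "F \<in> ?C" for F
    using that emb by (intro finite_subset[OF _ finite_embeddings[OF fin, of m E]]) blast
  hence "card (\<Union>F\<in>?C. ?L F) = (\<Sum>F\<in>?C. card (?L F))"
    by (intro card_UN_disjoint finC) auto
  thus ?thesis
    using card_L by (simp add: emb_def emb num_subgraphs_def)
qed

lemma drawn_cycle_pattern:
  "({..<m}, drawn_edges (cycle_pattern m) [0..<m]) = cycle_graph m"
  unfolding drawn_edges_def cycle_pattern_def cycle_graph_def by (auto intro!: image_eqI)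

lemma drawn_cycle_pattern_cover: "\<Union> (drawn_edges (cycle_pattern m) [0..<m]) = {..<m}"
  unfolding drawn_edges_def cycle_pattern_def by auto

lemma drawn_diamond: "drawn_edges diamond [0..<4] = {{0, 2}, {0, 3}, {1, 2}, {1, 3}, {2, 3}}"
  by (simp add: diamond_def numeral_2_eq_2)

lemma Q_graph_diamond: "({..<4}, drawn_edges diamond [0..<4]) = Q_graph"
proof -
  have "e \<in> {{0, 1}, {0, 2}, {0, 3}, {1, 2}, {1, 3}, {2, 3}}"
    if e: "e \<subseteq> {..<4}" "card e = 2" for e :: "nat set"
  proof -
    obtain a b where "e = {a, b}" "a < b"
      using e(2) by (metis card_2_iff insert_commute linorder_neqE_nat)
    moreover from this e(1) have "b \<in> {1, 2, 3}" "a \<in> {0, 1, 2}" by auto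
    ultimately show ?thesis by (elim insertE emptyE; simp)
  qed
  hence "{e. e \<subseteq> {..<4} \<and> card e = 2} =
      {{0, 1}, {0, 2}, {0, 3}, {1, 2}, {1, 3}, {2, 3 :: nat}}"
    by (intro equalityI subsetI) auto
  moreover have "{{0, 1}, {0, 2}, {0, 3}, {1, 2}, {1, 3}, {2, 3 :: nat}} - {{0, 1}} =
      {{0, 2}, {0, 3}, {1, 2}, {1, 3}, {2, 3}}"
    by (auto simp: doubleton_eq_iff)
  ultimately show ?thesis
    by (simp only: Q_graph_def complete_graph_def drawn_diamond fst_conv snd_conv)
qed

lemma emb_cycle_diamond:
  assumes "finite_simple_graph G"
  shows emb_cycle3: "emb G 3 (cycle_pattern 3) = 6 * num_subgraphs (cycle_graph 3) G"
    and emb_cycle4: "emb G 4 (cycle_pattern 4) = 8 * num_subgraphs (cycle_graph 4) G"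
    and emb_cycle5: "emb G 5 (cycle_pattern 5) = 10 * num_subgraphs (cycle_graph 5) G"
    and emb_diamond: "emb G 4 diamond = 4 * num_subgraphs Q_graph G"
proof -
  have wf: "wf_pattern 3 (cycle_pattern 3)" "wf_pattern 4 (cycle_pattern 4)"
      "wf_pattern 5 (cycle_pattern 5)" "wf_pattern 4 diamond"
    by code_simp+
  have aut: "length (filter (carries (cycle_pattern 3) (cycle_pattern 3)) (permutations_of_set_list [0..<3])) = 6"
    "length (filter (carries (cycle_pattern 4) (cycle_pattern 4)) (permutations_of_set_list [0..<4])) = 8"
    "length (filter (carries (cycle_pattern 5) (cycle_pattern 5)) (permutations_of_set_list [0..<5])) = 10"
    "length (filter (carries diamond diamond) (permutations_of_set_list [0..<4])) = 4"
    by code_simp+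
  have cover: "\<Union> (drawn_edges diamond [0..<4]) = {..<4}"
    by (auto simp: drawn_diamond)
  note emb = emb_eq_automorphisms_times_subgraphs[OF assms]
  show "emb G 3 (cycle_pattern 3) = 6 * num_subgraphs (cycle_graph 3) G"
    using emb[OF wf(1) drawn_cycle_pattern_cover] by (simp add: card_automorphisms wf aut drawn_cycle_pattern)
  show "emb G 4 (cycle_pattern 4) = 8 * num_subgraphs (cycle_graph 4) G"
    using emb[OF wf(2) drawn_cycle_pattern_cover] by (simp add: card_automorphisms wf aut drawn_cycle_pattern)
  show "emb G 5 (cycle_pattern 5) = 10 * num_subgraphs (cycle_graph 5) G"
    using emb[OF wf(3) drawn_cycle_pattern_cover] by (simp add: card_automorphisms wf aut drawn_cycle_pattern)
  show "emb G 4 diamond = 4 * num_subgraphs Q_graph G"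
    using emb[OF wf(4) cover] by (simp add: card_automorphisms wf aut Q_graph_diamond)
qed

section \<open>From embeddings to matchings\<close>

lemma drawn_matching_pattern:
  "drawn_edges (matching_pattern k) xs = (\<lambda>i. {xs ! (2 * i), xs ! (2 * i + 1)}) ` {..<k}"
  unfolding drawn_edges_def matching_pattern_def
  by (simp add: image_image atLeast0LessThan)

lemma drawn_matching_cover:
  assumes "length xs = 2 * k"
  shows "\<Union> (drawn_edges (matching_pattern k) xs) = set xs"
proof (intro equalityI subsetI)
  fix x assume "x \<in> set xs"
  then obtain j where j: "j < 2 * k" "x = xs ! j" using assms by (auto simp: in_set_conv_nth)
  hence "x \<in> {xs ! (2 * (j div 2)), xs ! (2 * (j div 2) + 1)}"
    by (cases "even j") (auto simp: odd_two_times_div_two_succ)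
  moreover have "j div 2 < k" using j by auto
  ultimately show "x \<in> \<Union> (drawn_edges (matching_pattern k) xs)"
    unfolding drawn_matching_pattern by blast
qed (use assms in \<open>auto simp: drawn_matching_pattern\<close>)

lemma drawn_matching_is_matching:
  assumes "length xs = 2 * k" "distinct xs"
  shows "card (drawn_edges (matching_pattern k) xs) = k"
    and "pairwise disjnt (drawn_edges (matching_pattern k) xs)"
proof -
  let ?e = "\<lambda>i. {xs ! (2 * i), xs ! (2 * i + 1)}"
  have disj: "?e i \<inter> ?e j = {}" if "i < k" "j < k" "i \<noteq> j" for i j
    using that assms by (auto simp: nth_eq_iff_index_eq)
  hence "inj_on ?e {..<k}"
    by (intro inj_onI) (metis Int_absorb insert_not_empty lessThan_iff)
  thus "card (drawn_edges (matching_pattern k) xs) = k"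
    by (simp only: drawn_matching_pattern card_image card_lessThan)
  show "pairwise disjnt (drawn_edges (matching_pattern k) xs)"
    using disj unfolding drawn_matching_pattern pairwise_def disjnt_def by fast
qed

lemma card_ordered_pairs:
  assumes "finite M" "\<And>e. e \<in> M \<Longrightarrow> card e = 2"
  shows "card {(a, b). {a, b} \<in> M} = 2 * card M"
    and "finite {(a, b). {a, b} \<in> M}"
proof -
  have two: "finite {(a, b). {a, b} = e} \<and> card {(a, b). {a, b} = e} = 2" if "e \<in> M" for e
  proof -
    obtain u v where "e = {u, v}" "u \<noteq> v" using assms(2)[OF \<open>e \<in> M\<close>] by (auto simp: card_2_iff)
    moreover from this have "{(a, b). {a, b} = e} = {(u, v), (v, u)}"
      by (auto simp: doubleton_eq_iff)
    ultimately show ?thesis by simp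
  qed
  have union: "{(a, b). {a, b} \<in> M} = (\<Union>e\<in>M. {(a, b). {a, b} = e})" by auto
  show "finite {(a, b). {a, b} \<in> M}" unfolding union using assms(1) two by blast
  have "card (\<Union>e\<in>M. {(a, b). {a, b} = e}) = (\<Sum>e\<in>M. card {(a, b). {a, b} = e})"
    using assms(1) two by (intro card_UN_disjoint) auto
  thus "card {(a, b). {a, b} \<in> M} = 2 * card M" unfolding union using two by simp
qed

definition matching_drawings :: "nat \<Rightarrow> 'a set set \<Rightarrow> 'a list set" where
  "matching_drawings k M =
     {xs. length xs = 2 * k \<and> distinct xs \<and> drawn_edges (matching_pattern k) xs = M}"

lemma drawn_matching_Suc:
  assumes "length xs = 2 * k"
  shows "drawn_edges (matching_pattern (Suc k)) (xs @ [a, b]) =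
    insert {a, b} (drawn_edges (matching_pattern k) xs)"
  using assms by (simp add: drawn_matching_pattern lessThan_Suc nth_append)

text \<open>The last edge that a drawing of \<open>M\<close> draws is any of the \<open>k\<close> edges of \<open>M\<close>, in either direction, and
  the rest is a drawing of the remaining edges, so each step contributes a factor \<open>2 * k\<close>.\<close>
lemma card_matching_drawings:
  assumes "finite M" "card M = k" "\<And>e. e \<in> M \<Longrightarrow> card e = 2" "pairwise disjnt M"
  shows "card (matching_drawings k M) = 2 ^ k * fact k"
  using assms
proof (induction k arbitrary: M)
  case 0
  hence "matching_drawings 0 M = {[]}"
    by (auto simp: matching_drawings_def matching_pattern_def)
  thus ?case by simp
next
  case (Suc k)
  let ?P = "{(a, b). {a, b} \<in> M}"
  let ?B = "\<lambda>(a, b). matching_drawings k (M - {{a, b}})"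
  let ?f = "\<lambda>((a, b), xs). xs @ [a, b]"
  have card_B: "card (?B ab) = 2 ^ k * fact k" if "ab \<in> ?P" for ab
  proof -
    have "card (matching_drawings k (M - {e})) = 2 ^ k * fact k" if "e \<in> M" for e
      using that Suc.prems by (intro Suc.IH) (auto simp: pairwise_def)
    thus ?thesis using that by auto
  qed
  have "matching_drawings (Suc k) M = ?f ` (SIGMA ab:?P. ?B ab)"
  proof (intro equalityI subsetI)
    fix zs assume zs: "zs \<in> matching_drawings (Suc k) M"
    hence "length zs = Suc (Suc (2 * k))" by (simp add: matching_drawings_def)
    then obtain xs a b where xs: "zs = xs @ [a, b]" "length xs = 2 * k"
      by (cases zs rule: rev_cases; cases "butlast zs" rule: rev_cases) auto
    have "{a, b} \<notin> drawn_edges (matching_pattern k) xs"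
      using zs xs drawn_matching_cover[of xs k] by (auto simp: matching_drawings_def)
    hence "((a, b), xs) \<in> (SIGMA ab:?P. ?B ab)"
      using zs xs drawn_matching_Suc[OF xs(2), of a b] by (auto simp: matching_drawings_def)
    thus "zs \<in> ?f ` (SIGMA ab:?P. ?B ab)" using xs by force
  next
    fix zs assume "zs \<in> ?f ` (SIGMA ab:?P. ?B ab)"
    then obtain a b xs where ab: "{a, b} \<in> M" and zs: "zs = xs @ [a, b]"
      and xs: "xs \<in> matching_drawings k (M - {{a, b}})" by auto
    have "set xs = \<Union> (M - {{a, b}})"
      using xs drawn_matching_cover[of xs k] by (auto simp: matching_drawings_def)
    moreover have "{a, b} \<inter> f = {}" if "f \<in> M - {{a, b}}" for f
      using pairwiseD[OF Suc.prems(4) ab, of f] that unfolding disjnt_def by blast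
    ultimately have "{a, b} \<inter> set xs = {}" by blast
    moreover have "a \<noteq> b" using Suc.prems(3)[OF ab] by auto
    ultimately show "zs \<in> matching_drawings (Suc k) M"
      using xs ab drawn_matching_Suc[of xs k a b] zs by (auto simp: matching_drawings_def)
  qed
  moreover have "inj_on ?f (SIGMA ab:?P. ?B ab)" by (auto simp: inj_on_def)
  moreover have "\<forall>ab\<in>?P. finite (?B ab)"
    using card_B by (intro ballI card_ge_0_finite) simp
  with card_ordered_pairs(2)[OF Suc.prems(1,3)]
  have "card (SIGMA ab:?P. ?B ab) = (\<Sum>ab\<in>?P. card (?B ab))" by (rule card_SigmaI)
  ultimately have "card (matching_drawings (Suc k) M) = (\<Sum>ab\<in>?P. card (?B ab))"
    by (simp only: card_image)
  also have "\<dots> = card ?P * (2 ^ k * fact k)"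
    using card_B by simp
  finally show ?case
    using card_ordered_pairs(1)[OF Suc.prems(1,3)] Suc.prems(2) by (simp add: algebra_simps)
qed

text \<open>The edges drawn by an embedding of the pattern form a \<open>k\<close>-matching, and conversely every drawing of
  a \<open>k\<close>-matching of \<open>G\<close> is an embedding.\<close>
lemma emb_matching_pattern:
  assumes G: "finite_simple_graph G"
  shows "emb G (2 * k) (matching_pattern k) = 2 ^ k * fact k * num_matchings G k"
proof -
  have finE: "finite (edges G)"
    using G by (intro finite_subset[of "edges G" "Pow (verts G)"])
      (auto simp: finite_simple_graph_def)
  hence fin: "finite (k_matchings G k)"
    by (intro finite_subset[of "k_matchings G k" "Pow (edges G)"]) (auto simp: k_matchings_def)
  have card: "card (matching_drawings k M) = 2 ^ k * fact k" if "M \<in> k_matchings G k" for M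
    using that G finite_subset[OF _ finE]
    by (intro card_matching_drawings) (auto simp: k_matchings_def finite_simple_graph_def)
  have emb: "embeddings G (2 * k) (matching_pattern k) = (\<Union>M\<in>k_matchings G k. matching_drawings k M)"
  proof (intro equalityI subsetI)
    fix xs assume xs: "xs \<in> embeddings G (2 * k) (matching_pattern k)"
    hence "drawn_edges (matching_pattern k) xs \<in> k_matchings G k"
      using drawn_matching_is_matching[of xs k] by (simp add: embeddings_def k_matchings_def)
    thus "xs \<in> (\<Union>M\<in>k_matchings G k. matching_drawings k M)"
      using xs by (auto simp: embeddings_def matching_drawings_def)
  next
    fix xs assume "xs \<in> (\<Union>M\<in>k_matchings G k. matching_drawings k M)"
    thus "xs \<in> embeddings G (2 * k) (matching_pattern k)"
      using G drawn_matching_cover[of xs k]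
      by (auto simp: embeddings_def matching_drawings_def k_matchings_def finite_simple_graph_def)
  qed
  have "finite (matching_drawings k M)" if "M \<in> k_matchings G k" for M
    using card[OF that] by (intro card_ge_0_finite) simp
  hence "emb G (2 * k) (matching_pattern k) = (\<Sum>M\<in>k_matchings G k. card (matching_drawings k M))"
    unfolding emb_def emb using fin
    by (intro card_UN_disjoint) (auto simp: matching_drawings_def)
  thus ?thesis using card by (simp add: num_matchings_def)
qed

section \<open>Cubic graphs of order ten\<close>

text \<open>With degree and order inserted, the relations become a triangular system of linear equations
  whose unknowns are the embedding numbers; dividing by the numbers of automorphisms gives the
  numbers of matchings.\<close>
lemma cubic_matching_numbers:
  assumes G: "finite_simple_graph G" and reg: "regular 3 G" and order: "graph_order G = 10"
  defines "g3 \<equiv> num_subgraphs (cycle_graph 3) G" and "g4 \<equiv> num_subgraphs (cycle_graph 4) G"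
    and "g5 \<equiv> num_subgraphs (cycle_graph 5) G" and "q \<equiv> num_subgraphs Q_graph G"
  shows "num_matchings G 0 = 1" and "num_matchings G 1 = 15" and "num_matchings G 2 = 75"
    and "num_matchings G 3 + g3 = 145" and "num_matchings G 4 + 3 * g3 = 90 + g4"
    and "num_matchings G 5 + 3 * g3 + g4 + g5 = 18 + 4 * q"
proof -
  interpret regular_graph G 3 using G reg by unfold_locales
  have n: "card (verts G) = 10" using order by (simp add: graph_order_def)
  have empty: "emb G 0 [] = 1"
  proof -
    have "embeddings G 0 [] = {[]}" by (auto simp: embeddings_def)
    thus ?thesis by (simp add: emb_def)
  qed
  have "isomorphic 2 (path_pattern 2) (matching_pattern 1)"
    "isomorphic 4 (path_pattern 4) (bridged_matching 2)" by code_simp+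
  note paths = this[THEN emb_isomorphic[OF finite_verts]]
  note linear = emb_path3 emb_path4 emb_path5 emb_path6 emb_chair emb_spider emb_paw emb_banner
    emb_lollipop emb_bull emb_square_edge emb_paw_edge emb_bridged_matching3 emb_bridged_matching4
    emb_matching1 emb_matching2 emb_matching3 emb_matching4 emb_matching5
  note rho = emb_matching_pattern[OF G, of 0] emb_matching_pattern[OF G, of 1]
    emb_matching_pattern[OF G, of 2] emb_matching_pattern[OF G, of 3]
    emb_matching_pattern[OF G, of 4] emb_matching_pattern[OF G, of 5]
  note relations = linear[unfolded n emb_cycle_diamond[OF G] paths empty, folded g3_def g4_def g5_def q_def]
  have "matching_pattern 0 = []" by (simp add: matching_pattern_def)
  thus "num_matchings G 0 = 1" using rho(1) empty by simp
  have r: "emb G 2 (matching_pattern 1) = 2 * num_matchings G 1"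
    "emb G 4 (matching_pattern 2) = 8 * num_matchings G 2"
    "emb G 6 (matching_pattern 3) = 48 * num_matchings G 3"
    "emb G 8 (matching_pattern 4) = 384 * num_matchings G 4"
    "emb G 10 (matching_pattern 5) = 3840 * num_matchings G 5"
    using rho by (simp_all add: fact_numeral)
  note system = relations[unfolded r]
  show "num_matchings G 1 = 15" using system by linarith
  show "num_matchings G 2 = 75" using system by linarith
  show "num_matchings G 3 + g3 = 145" using system by linarith
  show "num_matchings G 4 + 3 * g3 = 90 + g4" using system by linarith
  show "num_matchings G 5 + 3 * g3 + g4 + g5 = 18 + 4 * q" using system by linarith
qed

theorem theorem2p3:
  fixes G :: "'a ugraph" and x :: "int poly"
  assumes "finite_simple_graph G"
    and "regular 3 G"
    and "graph_order G = 10"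
  defines "x \<equiv> [:0, 1:]"
  shows "matching_poly G =
      x ^ 10 - 15 * x ^ 8 + 75 * x ^ 6 - 145 * x ^ 4 + 90 * x ^ 2 - 18
      + (x ^ 4 - 3 * x ^ 2 + 3) * of_nat (num_subgraphs (cycle_graph 3) G)
      + (x ^ 2 + 1) * of_nat (num_subgraphs (cycle_graph 4) G)
      + of_nat (num_subgraphs (cycle_graph 5) G)
      - 4 * of_nat (num_subgraphs Q_graph G)"
proof -
  note num = cubic_matching_numbers[OF assms(1-3)]
  let ?g3 = "int (num_subgraphs (cycle_graph 3) G)"
  let ?g4 = "int (num_subgraphs (cycle_graph 4) G)"
  let ?g5 = "int (num_subgraphs (cycle_graph 5) G)"
  let ?q = "int (num_subgraphs Q_graph G)"
  have monom: "monom c k = of_int c * x ^ k" for c :: int and k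
    by (simp add: x_def monom_altdef of_int_poly)
  have "matching_poly G = (\<Sum>k\<in>{0, 1, 2, 3, 4, 5}.
      monom ((-1) ^ k * int (num_matchings G k)) (10 - 2 * k))"
  proof -
    have "{0..graph_order G div 2} = {0, 1, 2, 3, 4, 5}" using assms(3) by auto
    thus ?thesis by (simp only: matching_poly_def assms(3))
  qed
  also have "\<dots> = of_int (int (num_matchings G 0)) * x ^ 10 - of_int (int (num_matchings G 1)) * x ^ 8
      + of_int (int (num_matchings G 2)) * x ^ 6 - of_int (int (num_matchings G 3)) * x ^ 4
      + of_int (int (num_matchings G 4)) * x ^ 2 - of_int (int (num_matchings G 5))"
    by (simp add: monom)
  also have "int (num_matchings G 3) = 145 - ?g3" using num(4) by linarith
  also have "int (num_matchings G 4) = 90 - 3 * ?g3 + ?g4" using num(5) by linarith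
  also have "int (num_matchings G 5) = 18 - 3 * ?g3 - ?g4 - ?g5 + 4 * ?q" using num(6) by linarith
  finally have poly: "matching_poly G = of_int (int (num_matchings G 0)) * x ^ 10
      - of_int (int (num_matchings G 1)) * x ^ 8 + of_int (int (num_matchings G 2)) * x ^ 6
      - of_int (145 - ?g3) * x ^ 4 + of_int (90 - 3 * ?g3 + ?g4) * x ^ 2
      - of_int (18 - 3 * ?g3 - ?g4 - ?g5 + 4 * ?q)" .
  show ?thesis
    unfolding poly num(1-3) by (simp add: algebra_simps)
qed

end
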